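(* The sequent calculus $\mathbf{LJ}$, viewed as a proof system for $\mathsf{IPC}$, has monotone feasible $\mathrm{PDIP}$: there is a polynomial $p$ such that for any $\mathbf{LJ}$-proof $u$ of an implication $\phi\to\psi\vee\theta$ with $\phi$ monotone, with code $w$, there are monotone circuits $C$ and $D$ of size at most $p(|u|,|w|)$ such that $([C],[D])$ is an $\mathsf{IPC}$-PDI for $\phi\to\psi\vee\theta$.
   Context: Formulas are over $\{\top,\bot,\wedge,\vee,\to\}$; monotone means containing no implication. $\mathbf{LJ}$ is Gentzen's intuitionistic sequent calculus with cut (the calculus $\mathbf{LK}$ restricted to sequents with at most one succedent formula); an $\mathbf{LJ}$-proof of a formula $\chi$ is a proof of $\Rightarrow\chi$. Monotone circuits have only $\top,\bot,\wedge,\vee$ gates; $[C]$ is the unfolded formula of $C$. An $\mathsf{IPC}$-PDI for $(\phi\to\psi\vee\theta)\in\mathsf{IPC}$ is a pair $(I,J)$ with atoms of $I,J$ among those of $\phi$ such that $\phi\to I\vee J$, $I\to\psi$, $J\to\theta$ are provable in $\mathsf{IPC}$. *)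

theory Defs
  imports Main "HOL-Computational_Algebra.Polynomial"
begin

section \<open>Formulas and intuitionistic propositional logic\<close>

datatype form =
    Atom nat
  | Top ("\<^bold>\<top>")
  | Bot ("\<^bold>\<bottom>")
  | Conj form form (infixr "\<^bold>\<and>" 75)
  | Disj form form (infixr "\<^bold>\<or>" 70)
  | Imp form form (infixr "\<^bold>\<rightarrow>" 65)

fun atoms :: "form \<Rightarrow> nat set" where
  "atoms (Atom n) = {n}"
| "atoms \<^bold>\<top> = {}"
| "atoms \<^bold>\<bottom> = {}"
| "atoms (A \<^bold>\<and> B) = atoms A \<union> atoms B"
| "atoms (A \<^bold>\<or> B) = atoms A \<union> atoms B"
| "atoms (A \<^bold>\<rightarrow> B) = atoms A \<union> atoms B"

fun monotone_form :: "form \<Rightarrow> bool" where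
  "monotone_form (Atom n) = True"
| "monotone_form \<^bold>\<top> = True"
| "monotone_form \<^bold>\<bottom> = True"
| "monotone_form (A \<^bold>\<and> B) = (monotone_form A \<and> monotone_form B)"
| "monotone_form (A \<^bold>\<or> B) = (monotone_form A \<and> monotone_form B)"
| "monotone_form (A \<^bold>\<rightarrow> B) = False"

text \<open>The standard Hilbert-style axiomatization; negation is \<open>A \<^bold>\<rightarrow> \<^bold>\<bottom>\<close>.\<close>

inductive_set IPC :: "form set" where
  K: "A \<^bold>\<rightarrow> B \<^bold>\<rightarrow> A \<in> IPC"
| S: "(A \<^bold>\<rightarrow> B \<^bold>\<rightarrow> C) \<^bold>\<rightarrow> (A \<^bold>\<rightarrow> B) \<^bold>\<rightarrow> A \<^bold>\<rightarrow> C \<in> IPC"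
| conjE1: "A \<^bold>\<and> B \<^bold>\<rightarrow> A \<in> IPC"
| conjE2: "A \<^bold>\<and> B \<^bold>\<rightarrow> B \<in> IPC"
| conjI: "A \<^bold>\<rightarrow> B \<^bold>\<rightarrow> A \<^bold>\<and> B \<in> IPC"
| disjI1: "A \<^bold>\<rightarrow> A \<^bold>\<or> B \<in> IPC"
| disjI2: "B \<^bold>\<rightarrow> A \<^bold>\<or> B \<in> IPC"
| disjE: "(A \<^bold>\<rightarrow> C) \<^bold>\<rightarrow> (B \<^bold>\<rightarrow> C) \<^bold>\<rightarrow> A \<^bold>\<or> B \<^bold>\<rightarrow> C \<in> IPC"
| topI: "\<^bold>\<top> \<in> IPC"
| botE: "\<^bold>\<bottom> \<^bold>\<rightarrow> A \<in> IPC"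
| MP: "A \<^bold>\<rightarrow> B \<in> IPC \<Longrightarrow> A \<in> IPC \<Longrightarrow> B \<in> IPC"

definition IPC_PDI :: "form \<Rightarrow> form \<Rightarrow> form \<Rightarrow> form \<Rightarrow> form \<Rightarrow> bool" where
  "IPC_PDI I J \<phi> \<psi> \<theta> \<longleftrightarrow>
     \<phi> \<^bold>\<rightarrow> \<psi> \<^bold>\<or> \<theta> \<in> IPC \<and>
     atoms I \<subseteq> atoms \<phi> \<and> atoms J \<subseteq> atoms \<phi> \<and>
     \<phi> \<^bold>\<rightarrow> I \<^bold>\<or> J \<in> IPC \<and> I \<^bold>\<rightarrow> \<psi> \<in> IPC \<and> J \<^bold>\<rightarrow> \<theta> \<in> IPC"

section \<open>Sequent calculus\<close>

datatype sequent = Sequent (ante: "form list") (succ: "form list") (infix "\<^bold>\<turnstile>" 50)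

text \<open>
  \<open>LK_rule Ps S\<close>: the sequent \<open>S\<close> follows from the premises \<open>Ps\<close> by one inference of
  Gentzen's \<open>LK\<close>. Cut and left implication split their contexts, as in Gentzen; only in this
  form does the restriction to at most one succedent formula yield the intended
  intuitionistic rules.
\<close>

inductive LK_rule :: "sequent list \<Rightarrow> sequent \<Rightarrow> bool" where
  Ax: "LK_rule [] ([A] \<^bold>\<turnstile> [A])"
| BotAx: "LK_rule [] ([\<^bold>\<bottom>] \<^bold>\<turnstile> [])"
| TopAx: "LK_rule [] ([] \<^bold>\<turnstile> [\<^bold>\<top>])"
| WeakL: "LK_rule [\<Gamma> \<^bold>\<turnstile> \<Delta>] (A # \<Gamma> \<^bold>\<turnstile> \<Delta>)"
| WeakR: "LK_rule [\<Gamma> \<^bold>\<turnstile> \<Delta>] (\<Gamma> \<^bold>\<turnstile> \<Delta> @ [A])"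
| ContrL: "LK_rule [A # A # \<Gamma> \<^bold>\<turnstile> \<Delta>] (A # \<Gamma> \<^bold>\<turnstile> \<Delta>)"
| ContrR: "LK_rule [\<Gamma> \<^bold>\<turnstile> \<Delta> @ [A, A]] (\<Gamma> \<^bold>\<turnstile> \<Delta> @ [A])"
| ExchL: "LK_rule [\<Gamma> @ A # B # \<Gamma>' \<^bold>\<turnstile> \<Delta>] (\<Gamma> @ B # A # \<Gamma>' \<^bold>\<turnstile> \<Delta>)"
| ExchR: "LK_rule [\<Gamma> \<^bold>\<turnstile> \<Delta> @ A # B # \<Delta>'] (\<Gamma> \<^bold>\<turnstile> \<Delta> @ B # A # \<Delta>')"
| Cut: "LK_rule [\<Gamma> \<^bold>\<turnstile> \<Delta> @ [A], A # \<Gamma>' \<^bold>\<turnstile> \<Delta>'] (\<Gamma> @ \<Gamma>' \<^bold>\<turnstile> \<Delta> @ \<Delta>')"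
| ConjL1: "LK_rule [A # \<Gamma> \<^bold>\<turnstile> \<Delta>] ((A \<^bold>\<and> B) # \<Gamma> \<^bold>\<turnstile> \<Delta>)"
| ConjL2: "LK_rule [B # \<Gamma> \<^bold>\<turnstile> \<Delta>] ((A \<^bold>\<and> B) # \<Gamma> \<^bold>\<turnstile> \<Delta>)"
| ConjR: "LK_rule [\<Gamma> \<^bold>\<turnstile> \<Delta> @ [A], \<Gamma> \<^bold>\<turnstile> \<Delta> @ [B]] (\<Gamma> \<^bold>\<turnstile> \<Delta> @ [A \<^bold>\<and> B])"
| DisjL: "LK_rule [A # \<Gamma> \<^bold>\<turnstile> \<Delta>, B # \<Gamma> \<^bold>\<turnstile> \<Delta>] ((A \<^bold>\<or> B) # \<Gamma> \<^bold>\<turnstile> \<Delta>)"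
| DisjR1: "LK_rule [\<Gamma> \<^bold>\<turnstile> \<Delta> @ [A]] (\<Gamma> \<^bold>\<turnstile> \<Delta> @ [A \<^bold>\<or> B])"
| DisjR2: "LK_rule [\<Gamma> \<^bold>\<turnstile> \<Delta> @ [B]] (\<Gamma> \<^bold>\<turnstile> \<Delta> @ [A \<^bold>\<or> B])"
| ImpL: "LK_rule [\<Gamma> \<^bold>\<turnstile> \<Delta> @ [A], B # \<Gamma>' \<^bold>\<turnstile> \<Delta>'] ((A \<^bold>\<rightarrow> B) # \<Gamma> @ \<Gamma>' \<^bold>\<turnstile> \<Delta> @ \<Delta>')"
| ImpR: "LK_rule [A # \<Gamma> \<^bold>\<turnstile> \<Delta> @ [B]] (\<Gamma> \<^bold>\<turnstile> \<Delta> @ [A \<^bold>\<rightarrow> B])"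

text \<open>
  Proofs are sequences of sequents in which a line may be used as a premise any number of
  times. A proof tree, listed in post-order, is such a sequence.
\<close>

definition LJ_derivation :: "sequent list \<Rightarrow> bool" where
  "LJ_derivation \<pi> \<longleftrightarrow>
     (\<forall>k < length \<pi>. length (succ (\<pi> ! k)) \<le> 1 \<and>
        (\<exists>Ps. set Ps \<subseteq> set (take k \<pi>) \<and> LK_rule Ps (\<pi> ! k)))"

definition LJ_proof :: "sequent list \<Rightarrow> form \<Rightarrow> bool" where
  "LJ_proof \<pi> \<chi> \<longleftrightarrow> LJ_derivation \<pi> \<and> \<pi> \<noteq> [] \<and> last \<pi> = ([] \<^bold>\<turnstile> [\<chi>])"

section \<open>Codes\<close>

text \<open>
  Formulas and proofs are coded as words over a finite alphabet: formulas in prefix notation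
  with the indices of atoms written in binary. Prefix notation makes separators between the
  formulas of a sequent unnecessary.
\<close>

datatype symbol = SAtom | SDigit bool | STop | SBot | SConj | SDisj | SImp | STurnstile | SEnd

fun binary :: "nat \<Rightarrow> bool list" where
  "binary n = (if n = 0 then [] else odd n # binary (n div 2))"

declare binary.simps [simp del]

fun form_code :: "form \<Rightarrow> symbol list" where
  "form_code (Atom n) = SAtom # map SDigit (binary n)"
| "form_code \<^bold>\<top> = [STop]"
| "form_code \<^bold>\<bottom> = [SBot]"
| "form_code (A \<^bold>\<and> B) = SConj # form_code A @ form_code B"
| "form_code (A \<^bold>\<or> B) = SDisj # form_code A @ form_code B"
| "form_code (A \<^bold>\<rightarrow> B) = SImp # form_code A @ form_code B"

definition forms_code :: "form list \<Rightarrow> symbol list" where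
  "forms_code \<Gamma> = concat (map form_code \<Gamma>)"

fun sequent_code :: "sequent \<Rightarrow> symbol list" where
  "sequent_code (\<Gamma> \<^bold>\<turnstile> \<Delta>) = forms_code \<Gamma> @ STurnstile # forms_code \<Delta> @ [SEnd]"

definition proof_code :: "sequent list \<Rightarrow> symbol list" where
  "proof_code \<pi> = concat (map sequent_code \<pi>)"

lemma binary_0: "binary 0 = []"
  by (subst binary.simps) simp

lemma binary_pos: "n \<noteq> 0 \<Longrightarrow> binary n = odd n # binary (n div 2)"
  by (subst binary.simps) simp

lemma inj_binary: "binary m = binary n \<Longrightarrow> m = n"
proof (induction m arbitrary: n rule: less_induct)
  case (less m)
  show ?case
  proof (cases "m = 0 \<or> n = 0")
    case True
    then show ?thesis
      using less.prems binary_pos by (metis binary_0 list.distinct(1))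
  next
    case False
    then have "odd m # binary (m div 2) = odd n # binary (n div 2)"
      using less.prems by (metis binary_pos)
    then have *: "odd m = odd n" and **: "binary (m div 2) = binary (n div 2)"
      by simp_all
    from False have "m div 2 < m" by simp
    from less.IH[OF this **] * show ?thesis by presburger
  qed
qed

definition digit_free :: "symbol list \<Rightarrow> bool" where
  "digit_free xs \<longleftrightarrow> (\<forall>b ys. xs \<noteq> SDigit b # ys)"

lemma digits_append:
  assumes "map SDigit ds @ xs = map SDigit es @ ys" "digit_free xs" "digit_free ys"
  shows "ds = es \<and> xs = ys"
  using assms
proof (induction ds arbitrary: es)
  case Nil
  then show ?case by (cases es) (auto simp: digit_free_def)
next
  case (Cons d ds)
  then show ?case by (cases es) (auto simp: digit_free_def)
qed

lemma digit_free_form_code: "digit_free (form_code A @ xs)"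
  by (cases A) (auto simp: digit_free_def)

lemma form_code_append:
  "form_code A @ xs = form_code B @ ys \<Longrightarrow> digit_free xs \<Longrightarrow> digit_free ys \<Longrightarrow> A = B \<and> xs = ys"
proof (induction A arbitrary: B xs ys)
  case (Atom n)
  then show ?case by (cases B) (auto dest: digits_append inj_binary)
next
  case Top
  then show ?case by (cases B) auto
next
  case Bot
  then show ?case by (cases B) auto
next
  case (Conj A1 A2)
  from Conj.prems(1) obtain B1 B2 where B: "B = Conj B1 B2"
    and eq: "form_code A1 @ form_code A2 @ xs = form_code B1 @ form_code B2 @ ys"
    by (cases B) auto
  from Conj.IH(1)[OF eq digit_free_form_code digit_free_form_code]
  have "A1 = B1" and eq2: "form_code A2 @ xs = form_code B2 @ ys" by simp_all
  with Conj.IH(2)[OF eq2 Conj.prems(2,3)] B show ?case by simp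
next
  case (Disj A1 A2)
  from Disj.prems(1) obtain B1 B2 where B: "B = Disj B1 B2"
    and eq: "form_code A1 @ form_code A2 @ xs = form_code B1 @ form_code B2 @ ys"
    by (cases B) auto
  from Disj.IH(1)[OF eq digit_free_form_code digit_free_form_code]
  have "A1 = B1" and eq2: "form_code A2 @ xs = form_code B2 @ ys" by simp_all
  with Disj.IH(2)[OF eq2 Disj.prems(2,3)] B show ?case by simp
next
  case (Imp A1 A2)
  from Imp.prems(1) obtain B1 B2 where B: "B = Imp B1 B2"
    and eq: "form_code A1 @ form_code A2 @ xs = form_code B1 @ form_code B2 @ ys"
    by (cases B) auto
  from Imp.IH(1)[OF eq digit_free_form_code digit_free_form_code]
  have "A1 = B1" and eq2: "form_code A2 @ xs = form_code B2 @ ys" by simp_all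
  with Imp.IH(2)[OF eq2 Imp.prems(2,3)] B show ?case by simp
qed

lemma inj_form_code: "inj form_code"
  using form_code_append[where xs = "[]" and ys = "[]"] by (auto simp: inj_def digit_free_def)

lemma forms_code_append:
  assumes "forms_code \<Gamma> @ s # xs = forms_code \<Delta> @ s # ys" "s \<in> {STurnstile, SEnd}"
  shows "\<Gamma> = \<Delta> \<and> xs = ys"
  using assms(1)
proof (induction \<Gamma> arbitrary: \<Delta>)
  case Nil
  have hd: "hd (form_code A) \<noteq> s \<and> form_code A \<noteq> []" for A using assms(2) by (cases A) auto
  show ?case
  proof (cases \<Delta>)
    case Nil
    then show ?thesis using Nil.prems by (simp add: forms_code_def)
  next
    case (Cons B \<Delta>')
    then show ?thesis using Nil.prems hd[of B]
      by (cases "form_code B") (auto simp: forms_code_def)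
  qed
next
  case (Cons A \<Gamma>)
  have hd: "hd (form_code A) \<noteq> s \<and> form_code A \<noteq> []" for A using assms(2) by (cases A) auto
  have df: "digit_free (forms_code \<Gamma> @ s # zs)" for \<Gamma> zs
    using assms(2) digit_free_form_code
    by (cases \<Gamma>) (auto simp: forms_code_def digit_free_def)
  show ?case
  proof (cases \<Delta>)
    case Nil
    then show ?thesis using Cons.prems hd[of A]
      by (cases "form_code A") (auto simp: forms_code_def)
  next
    case (Cons B \<Delta>')
    then have "form_code A @ forms_code \<Gamma> @ s # xs = form_code B @ forms_code \<Delta>' @ s # ys"
      using Cons.prems by (simp add: forms_code_def)
    from form_code_append[OF this df df] Cons.IH Cons show ?thesis by auto
  qed
qed

lemma sequent_code_append:
  "sequent_code S @ xs = sequent_code T @ ys \<Longrightarrow> S = T \<and> xs = ys"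
  by (cases S; cases T) (auto dest!: forms_code_append)

lemma inj_proof_code: "inj proof_code"
proof (rule injI)
  have ne: "sequent_code S \<noteq> []" for S by (cases S) simp
  show "\<pi> = \<rho>" if "proof_code \<pi> = proof_code \<rho>" for \<pi> \<rho>
    using that
  proof (induction \<pi> arbitrary: \<rho>)
    case Nil
    then show ?case using ne by (cases \<rho>) (auto simp: proof_code_def)
  next
    case (Cons S \<pi>)
    then show ?case using ne
      by (cases \<rho>) (auto simp: proof_code_def dest!: sequent_code_append)
  qed
qed

section \<open>Monotone circuits\<close>

text \<open>
  A circuit is the list of its nodes in a topological order, where the inputs of a gate are
  given by the positions of earlier nodes; the last node is the output. The size counts all
  nodes, including the input nodes.
\<close>

datatype node = InputN nat | TopN | BotN | ConjN nat nat | DisjN nat nat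

type_synonym mcircuit = "node list"

fun node_inputs :: "node \<Rightarrow> nat set" where
  "node_inputs (ConjN i j) = {i, j}"
| "node_inputs (DisjN i j) = {i, j}"
| "node_inputs _ = {}"

definition monotone_circuit :: "mcircuit \<Rightarrow> bool" where
  "monotone_circuit C \<longleftrightarrow> C \<noteq> [] \<and> (\<forall>k < length C. \<forall>i \<in> node_inputs (C ! k). i < k)"

definition circuit_size :: "mcircuit \<Rightarrow> nat" where
  "circuit_size C = length C"

fun node_form :: "form list \<Rightarrow> node \<Rightarrow> form" where
  "node_form fs (InputN n) = Atom n"
| "node_form fs TopN = \<^bold>\<top>"
| "node_form fs BotN = \<^bold>\<bottom>"
| "node_form fs (ConjN i j) = fs ! i \<^bold>\<and> fs ! j"
| "node_form fs (DisjN i j) = fs ! i \<^bold>\<or> fs ! j"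

text \<open>\<open>node_forms C ! k\<close> is the formula obtained by unfolding \<open>C\<close> at its node \<open>k\<close>.\<close>

definition node_forms :: "mcircuit \<Rightarrow> form list" where
  "node_forms C = foldl (\<lambda>fs g. fs @ [node_form fs g]) [] C"

definition unfolding_form :: "mcircuit \<Rightarrow> form" where
  "unfolding_form C = last (node_forms C)"

section \<open>Bivariate polynomials\<close>

definition poly2 :: "nat poly poly \<Rightarrow> nat \<Rightarrow> nat \<Rightarrow> nat" where
  "poly2 p m n = poly (poly p [:m:]) n"

end

theory Submission
  imports Defs
begin

text \<open>
  Fix a truth assignment to the atoms of \<open>\<phi>\<close>. Let \<open>T\<close> be the least set of subformulas of the
  proof that contains the true atoms and \<open>\<^bold>\<top>\<close>, is closed under introducing conjunctions and
  disjunctions, and contains \<open>A\<close> whenever the proof has a line \<open>\<Gamma> \<^bold>\<turnstile> A\<close> with \<open>\<Gamma> \<subseteq> T\<close>. All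
  elements of \<open>T\<close> are intuitionistic consequences of the true atoms. Every line of the proof
  preserves Kleene's slash relative to \<open>T\<close> (where \<open>A \<^bold>\<rightarrow> B\<close> is slashed if it belongs to \<open>T\<close> and
  slashing \<open>A\<close> implies slashing \<open>B\<close>), and slashed formulas belong to \<open>T\<close>. Hence, if \<open>\<phi>\<close> is true,
  then \<open>\<psi>\<close> or \<open>\<theta>\<close> belongs to \<open>T\<close>. Membership in \<open>T\<close> is a fixed point of Horn clauses reached
  after polynomially many rounds, so it is computed by small monotone circuits; these give the
  interpolants, because valid implications between monotone formulas are intuitionistically
  provable.
\<close>

section \<open>Derivability from assumptions\<close>

text \<open>Hypotheses form a set, so exchange, contraction and weakening on the left cost nothing
  beyond \<open>ded_mono\<close>.\<close>

inductive ded :: "form set \<Rightarrow> form \<Rightarrow> bool" for \<Gamma> where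
  assm: "A \<in> \<Gamma> \<Longrightarrow> ded \<Gamma> A"
| ipc: "A \<in> IPC \<Longrightarrow> ded \<Gamma> A"
| mp: "ded \<Gamma> (A \<^bold>\<rightarrow> B) \<Longrightarrow> ded \<Gamma> A \<Longrightarrow> ded \<Gamma> B"

lemma ded_empty: "ded {} A \<Longrightarrow> A \<in> IPC"
  by (induction rule: ded.induct) (auto intro: IPC.MP)

lemma ded_cut: "ded \<Gamma> A \<Longrightarrow> (\<And>B. B \<in> \<Gamma> \<Longrightarrow> ded \<Delta> B) \<Longrightarrow> ded \<Delta> A"
  by (induction rule: ded.induct) (auto intro: ded.intros)

lemma ded_mono: "ded \<Gamma> A \<Longrightarrow> \<Gamma> \<subseteq> \<Delta> \<Longrightarrow> ded \<Delta> A"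
  by (erule ded_cut) (auto intro: ded.assm)

text \<open>The deduction theorem: \<open>K\<close> covers hypotheses and theorems, \<open>S\<close>
  pushes the implication through modus ponens.\<close>

lemma ded_impI: "ded (insert A \<Gamma>) B \<Longrightarrow> ded \<Gamma> (A \<^bold>\<rightarrow> B)"
proof (induction rule: ded.induct)
  case (assm B)
  have "A \<^bold>\<rightarrow> A \<in> IPC"
    by (rule IPC.MP[OF IPC.MP[OF IPC.S IPC.K] IPC.K[of _ A]])
  with assm show ?case by (auto intro: ded.intros IPC.K)
next
  case (ipc B)
  then show ?case by (meson ded.ipc IPC.K IPC.MP)
next
  case (mp B C)
  then show ?case by (meson ded.mp ded.ipc IPC.S)
qed

lemma ded_conjI: "ded \<Gamma> A \<Longrightarrow> ded \<Gamma> B \<Longrightarrow> ded \<Gamma> (A \<^bold>\<and> B)"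
  by (meson ded.mp ded.ipc IPC.conjI)

lemma ded_conjD1: "ded \<Gamma> (A \<^bold>\<and> B) \<Longrightarrow> ded \<Gamma> A"
  by (meson ded.mp ded.ipc IPC.conjE1)

lemma ded_conjD2: "ded \<Gamma> (A \<^bold>\<and> B) \<Longrightarrow> ded \<Gamma> B"
  by (meson ded.mp ded.ipc IPC.conjE2)

lemma ded_disjI1: "ded \<Gamma> A \<Longrightarrow> ded \<Gamma> (A \<^bold>\<or> B)"
  by (meson ded.mp ded.ipc IPC.disjI1)

lemma ded_disjI2: "ded \<Gamma> B \<Longrightarrow> ded \<Gamma> (A \<^bold>\<or> B)"
  by (meson ded.mp ded.ipc IPC.disjI2)

lemma ded_botE: "ded \<Gamma> \<^bold>\<bottom> \<Longrightarrow> ded \<Gamma> A"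
  by (meson ded.mp ded.ipc IPC.botE)

lemma ded_insert_cut: "ded \<Gamma> A \<Longrightarrow> ded (insert A \<Gamma>) B \<Longrightarrow> ded \<Gamma> B"
  by (meson ded.mp ded_impI)

lemma ded_disjL:
  assumes "ded (insert A \<Gamma>) C" "ded (insert B \<Gamma>) C"
  shows "ded (insert (A \<^bold>\<or> B) \<Gamma>) C"
proof -
  let ?\<Delta> = "insert (A \<^bold>\<or> B) \<Gamma>"
  have "ded ?\<Delta> (A \<^bold>\<rightarrow> C)" "ded ?\<Delta> (B \<^bold>\<rightarrow> C)"
    using assms by (auto intro!: ded_impI elim: ded_mono)
  moreover have "ded ?\<Delta> (A \<^bold>\<or> B)" by (simp add: ded.assm)
  ultimately show ?thesis by (meson ded.mp ded.ipc IPC.disjE)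
qed

lemma ded_conjL:
  assumes "ded (insert A (insert B \<Gamma>)) C"
  shows "ded (insert (A \<^bold>\<and> B) \<Gamma>) C"
proof (rule ded_cut[OF assms])
  have "ded (insert (A \<^bold>\<and> B) \<Gamma>) (A \<^bold>\<and> B)" by (simp add: ded.assm)
  then show "ded (insert (A \<^bold>\<and> B) \<Gamma>) D" if "D \<in> insert A (insert B \<Gamma>)" for D
    using that by (auto intro: ded_conjD1 ded_conjD2 ded.assm)
qed

lemma ded_single_imp: "ded {A} B \<Longrightarrow> A \<^bold>\<rightarrow> B \<in> IPC"
  by (simp add: ded_empty ded_impI)

section \<open>Soundness of the sequent calculus\<close>

fun succ_form :: "form list \<Rightarrow> form" where
  "succ_form [] = \<^bold>\<bottom>"
| "succ_form (A # \<Delta>) = A"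

text \<open>The length bounds turn each \<open>LK\<close> rule into its intuitionistic form. In
  \<open>Cut\<close> and \<open>ImpL\<close> the bound on the left premise forces \<Delta> to be
  empty; an empty succedent is read as falsum.\<close>

lemma LK_rule_sound:
  assumes "LK_rule Ps S" "\<forall>P \<in> set Ps. length (succ P) \<le> 1 \<and> ded (set (ante P)) (succ_form (succ P))"
    and "length (succ S) \<le> 1"
  shows "ded (set (ante S)) (succ_form (succ S))"
  using assms
proof (cases rule: LK_rule.cases)
  case (WeakR \<Gamma> \<Delta> A)
  then show ?thesis using assms(2,3) by (auto intro: ded_botE)
next
  case (Cut \<Gamma> \<Delta> A \<Gamma>' \<Delta>')
  then have prems: "ded (set \<Gamma>) A" "ded (insert A (set \<Gamma>')) (succ_form \<Delta>')" "\<Delta> = []"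
    using assms(2) by auto
  have "ded (set \<Gamma> \<union> set \<Gamma>') A" by (rule ded_mono[OF prems(1)]) auto
  moreover have "ded (insert A (set \<Gamma> \<union> set \<Gamma>')) (succ_form \<Delta>')"
    by (rule ded_mono[OF prems(2)]) auto
  ultimately have "ded (set \<Gamma> \<union> set \<Gamma>') (succ_form \<Delta>')" by (rule ded_insert_cut)
  with Cut prems(3) show ?thesis by simp
next
  case (ConjL1 A \<Gamma> \<Delta> B)
  then show ?thesis using assms(2) by (auto intro!: ded_conjL elim: ded_mono)
next
  case (ConjL2 B \<Gamma> \<Delta> A)
  then show ?thesis using assms(2) by (auto intro!: ded_conjL elim: ded_mono)
next
  case (ImpL \<Gamma> \<Delta> A B \<Gamma>' \<Delta>')
  let ?\<Sigma> = "insert (A \<^bold>\<rightarrow> B) (set \<Gamma> \<union> set \<Gamma>')"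
  from ImpL have prems: "ded (set \<Gamma>) A" "ded (insert B (set \<Gamma>')) (succ_form \<Delta>')" "\<Delta> = []"
    using assms(2) by auto
  have "ded ?\<Sigma> A" by (rule ded_mono[OF prems(1)]) auto
  then have "ded ?\<Sigma> B" by (rule ded.mp[rotated]) (simp add: ded.assm)
  moreover have "ded (insert B ?\<Sigma>) (succ_form \<Delta>')" by (rule ded_mono[OF prems(2)]) auto
  ultimately have "ded ?\<Sigma> (succ_form \<Delta>')" by (rule ded_insert_cut)
  with ImpL prems(3) show ?thesis by simp
next
  case (WeakL \<Gamma> \<Delta> A)
  then show ?thesis using assms(2) by (auto elim: ded_mono)
next
  case (ConjR \<Gamma> \<Delta> A B)
  then show ?thesis using assms(2) by (auto intro: ded_conjI)
next
  case (DisjL A \<Gamma> \<Delta> B)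
  then show ?thesis using assms(2) by (auto intro: ded_disjL)
next
  case (DisjR1 \<Gamma> \<Delta> A B)
  then show ?thesis using assms(2) by (auto intro: ded_disjI1)
next
  case (DisjR2 \<Gamma> \<Delta> B A)
  then show ?thesis using assms(2) by (auto intro: ded_disjI2)
next
  case (ImpR A \<Gamma> \<Delta> B)
  then show ?thesis using assms(2) by (auto intro: ded_impI)
\<comment> \<open>Besides axioms and left structural rules, \<open>ContrR\<close> and
  \<open>ExchR\<close> remain; they are vacuous, since their premises have two succedent
  formulas.\<close>
qed (use assms(2,3) in \<open>auto simp: insert_commute intro: ded.assm ded.ipc IPC.topI\<close>)

text \<open>Strong induction on the position of a line, as any earlier line may serve as a premise.
  The step also receives membership in \<pi>, because the slash argument uses that the closure is
  closed under the lines of \<pi>.\<close>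

lemma LJ_derivation_induct:
  assumes "LJ_derivation \<pi>" "S \<in> set \<pi>"
    and step: "\<And>Ps S. \<lbrakk>S \<in> set \<pi>; LK_rule Ps S; length (succ S) \<le> 1;
      \<And>P. P \<in> set Ps \<Longrightarrow> P \<in> set \<pi> \<and> length (succ P) \<le> 1 \<and> Q P\<rbrakk> \<Longrightarrow> Q S"
  shows "Q S"
proof -
  have succ1: "length (succ P) \<le> 1" if "P \<in> set \<pi>" for P
    using assms(1) that by (auto simp: LJ_derivation_def in_set_conv_nth)
  have "Q (\<pi> ! k)" if "k < length \<pi>" for k
    using that
  proof (induction k rule: less_induct)
    case (less k)
    then obtain Ps where Ps: "set Ps \<subseteq> set (take k \<pi>)" "LK_rule Ps (\<pi> ! k)"
      using assms(1) by (auto simp: LJ_derivation_def)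
    show ?case
    proof (rule step[OF _ Ps(2)])
      show "P \<in> set \<pi> \<and> length (succ P) \<le> 1 \<and> Q P" if "P \<in> set Ps" for P
      proof -
        from that Ps(1) obtain i where "i < k" "P = \<pi> ! i"
          by (auto simp: in_set_conv_nth subset_iff)
        with less succ1[of P] show ?thesis by simp
      qed
    qed (use less.prems succ1 in auto)
  qed
  then show ?thesis using assms(2) by (auto simp: in_set_conv_nth)
qed

lemma LJ_sound:
  assumes "LJ_derivation \<pi>" "S \<in> set \<pi>"
  shows "ded (set (ante S)) (succ_form (succ S))"
  using assms
proof (rule LJ_derivation_induct)
  fix Ps S
  assume "LK_rule Ps S" "length (succ S) \<le> 1"
    and "\<And>P. P \<in> set Ps \<Longrightarrow>
      P \<in> set \<pi> \<and> length (succ P) \<le> 1 \<and> ded (set (ante P)) (succ_form (succ P))"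
  then show "ded (set (ante S)) (succ_form (succ S))"
    using LK_rule_sound by simp
qed

section \<open>Monotone formulas\<close>

fun holds :: "nat set \<Rightarrow> form \<Rightarrow> bool" where
  "holds a (Atom n) \<longleftrightarrow> n \<in> a"
| "holds a \<^bold>\<top> \<longleftrightarrow> True"
| "holds a \<^bold>\<bottom> \<longleftrightarrow> False"
| "holds a (A \<^bold>\<and> B) \<longleftrightarrow> holds a A \<and> holds a B"
| "holds a (A \<^bold>\<or> B) \<longleftrightarrow> holds a A \<or> holds a B"
| "holds a (A \<^bold>\<rightarrow> B) \<longleftrightarrow> (holds a A \<longrightarrow> holds a B)"

lemma holds_mono: "monotone_form A \<Longrightarrow> a \<subseteq> b \<Longrightarrow> holds a A \<Longrightarrow> holds b A"
  by (induction A) auto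

lemma holds_ded: "monotone_form A \<Longrightarrow> holds a A \<Longrightarrow> ded (Atom ` a) A"
  by (induction A) (auto intro: ded.assm ded.ipc IPC.topI ded_conjI ded_disjI1 ded_disjI2)

text \<open>A monotone formula acts like the disjunction, over its satisfying assignments, of the
  conjunction of the true atoms. \<Gamma> is arbitrary so that one conjunct can be carried along
  while the other is decomposed.\<close>

lemma ded_monotone_left:
  assumes "monotone_form A" "\<And>a. holds a A \<Longrightarrow> ded (Atom ` a \<union> \<Gamma>) C"
  shows "ded (insert A \<Gamma>) C"
  using assms
proof (induction A arbitrary: \<Gamma>)
  case (Atom n)
  show ?case using Atom.prems(2)[of "{n}"] by simp
next
  case Top
  show ?case using Top.prems(2)[of "{}"] by (auto elim: ded_mono)
next
  case Bot
  show ?case by (simp add: ded_botE ded.assm)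
next
  case (Conj A B)
  have "ded (insert A (insert B \<Gamma>)) C"
  proof (rule Conj.IH(1))
    fix a assume a: "holds a A"
    have "ded (insert B (Atom ` a \<union> \<Gamma>)) C"
    proof (rule Conj.IH(2))
      fix b assume "holds b B"
      \<comment> \<open>By monotonicity, merging an assignment for each conjunct satisfies
        both.\<close>
      with a Conj.prems(1) have "holds (a \<union> b) (A \<^bold>\<and> B)"
        by (auto intro: holds_mono)
      from Conj.prems(2)[OF this] show "ded (Atom ` b \<union> (Atom ` a \<union> \<Gamma>)) C"
        by (rule ded_mono) auto
    qed (use Conj.prems(1) in simp)
    then show "ded (Atom ` a \<union> insert B \<Gamma>) C" by simp
  qed (use Conj.prems(1) in simp)
  then show ?case by (rule ded_conjL)
next
  case (Disj A B)
  then show ?case by (auto intro!: ded_disjL)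
qed simp

text \<open>For monotone formulas truth tables suffice: the atoms true under an assignment
  satisfying \<open>A\<close> already derive \<open>B\<close>.\<close>

lemma monotone_entails_IPC:
  assumes "monotone_form A" "monotone_form B" "\<And>a. holds a A \<Longrightarrow> holds a B"
  shows "A \<^bold>\<rightarrow> B \<in> IPC"
  using ded_monotone_left[of A "{}" B] assms by (auto intro: ded_single_imp holds_ded)

section \<open>Circuits from subformulas\<close>

fun subforms :: "form \<Rightarrow> form set" where
  "subforms (A \<^bold>\<and> B) = insert (A \<^bold>\<and> B) (subforms A \<union> subforms B)"
| "subforms (A \<^bold>\<or> B) = insert (A \<^bold>\<or> B) (subforms A \<union> subforms B)"
| "subforms (A \<^bold>\<rightarrow> B) = insert (A \<^bold>\<rightarrow> B) (subforms A \<union> subforms B)"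
| "subforms A = {A}"

lemma finite_subforms [simp]: "finite (subforms A)"
  by (induction A) auto

lemma subforms_refl [simp]: "A \<in> subforms A"
  by (cases A) auto

lemma subforms_trans: "B \<in> subforms A \<Longrightarrow> subforms B \<subseteq> subforms A"
  by (induction A) auto

lemma node_forms_simps:
  "node_forms [] = []" "node_forms (C @ [g]) = node_forms C @ [node_form (node_forms C) g]"
  by (simp_all add: node_forms_def)

lemma length_node_forms [simp]: "length (node_forms C) = length C"
  by (induction C rule: rev_induct) (simp_all add: node_forms_simps)

lemma take_node_forms: "take k (node_forms C) = node_forms (take k C)"
  by (induction C rule: rev_induct) (auto simp: node_forms_simps not_le take_Cons')

text \<open>Unlike \<open>monotone_circuit\<close>, this admits the empty list, from which circuits
  are built up.\<close>

definition topo_ordered :: "node list \<Rightarrow> bool" where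
  "topo_ordered C \<longleftrightarrow> (\<forall>k < length C. \<forall>i \<in> node_inputs (C ! k). i < k)"

lemma topo_ordered_snoc:
  "topo_ordered C \<Longrightarrow> \<forall>i \<in> node_inputs g. i < length C \<Longrightarrow> topo_ordered (C @ [g])"
  by (auto simp: topo_ordered_def nth_append less_Suc_eq)

text \<open>One node per formula of \<open>F\<close>: distinctness makes the number of nodes equal
  to the cardinality of \<open>F\<close>, so circuit size is measured by counting distinct
  subformulas.\<close>

definition circuit_for :: "node list \<Rightarrow> form set \<Rightarrow> bool" where
  "circuit_for C F \<longleftrightarrow> topo_ordered C \<and> distinct (node_forms C) \<and> set (node_forms C) = F"

lemma circuit_for_insert:
  assumes "circuit_for C F" "\<forall>i \<in> node_inputs g. i < length C" "node_form (node_forms C) g = A"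
  shows "\<exists>C'. circuit_for C' (insert A F)"
proof (cases "A \<in> F")
  case True
  with assms(1) show ?thesis by (auto simp: insert_absorb)
next
  case False
  with assms have "circuit_for (C @ [g]) (insert A F)"
    by (simp add: circuit_for_def node_forms_simps topo_ordered_snoc)
  then show ?thesis by blast
qed

lemma circuit_for_nth:
  assumes "circuit_for C F" "A \<in> F"
  obtains i where "i < length C" "node_forms C ! i = A"
  using assms by (auto simp: circuit_for_def in_set_conv_nth)

lemma circuit_for_subforms:
  "circuit_for C F \<Longrightarrow> monotone_form A \<Longrightarrow> \<exists>C'. circuit_for C' (F \<union> subforms A)"
proof (induction A arbitrary: C F)
  case (Atom n)
  then show ?case using circuit_for_insert[of C F "InputN n"] by simp
next
  case Top
  then show ?case using circuit_for_insert[of C F TopN] by simp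
next
  case Bot
  then show ?case using circuit_for_insert[of C F BotN] by simp
next
  case (Conj A B)
  from Conj.prems Conj.IH(1)[of C F] obtain C1 where "circuit_for C1 (F \<union> subforms A)" by auto
  with Conj.prems Conj.IH(2) obtain C2 where C2: "circuit_for C2 (F \<union> subforms A \<union> subforms B)"
    by fastforce
  obtain i where "i < length C2" "node_forms C2 ! i = A"
    using circuit_for_nth[OF C2, of A] by auto
  moreover obtain j where "j < length C2" "node_forms C2 ! j = B"
    using circuit_for_nth[OF C2, of B] by auto
  ultimately show ?case
    using circuit_for_insert[OF C2, of "ConjN i j"] by (simp add: Un_assoc)
next
  case (Disj A B)
  from Disj.prems Disj.IH(1)[of C F] obtain C1 where "circuit_for C1 (F \<union> subforms A)" by auto
  with Disj.prems Disj.IH(2) obtain C2 where C2: "circuit_for C2 (F \<union> subforms A \<union> subforms B)"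
    by fastforce
  obtain i where "i < length C2" "node_forms C2 ! i = A"
    using circuit_for_nth[OF C2, of A] by auto
  moreover obtain j where "j < length C2" "node_forms C2 ! j = B"
    using circuit_for_nth[OF C2, of B] by auto
  ultimately show ?case
    using circuit_for_insert[OF C2, of "DisjN i j"] by (simp add: Un_assoc)
qed simp

lemma circuit_of_monotone_form:
  assumes "monotone_form A"
  shows "\<exists>C. monotone_circuit C \<and> unfolding_form C = A \<and> circuit_size C \<le> card (subforms A)"
proof -
  obtain C where C: "topo_ordered C" "distinct (node_forms C)" "set (node_forms C) = subforms A"
    using circuit_for_subforms[of "[]" "{}" A] assms
    by (auto simp: circuit_for_def topo_ordered_def node_forms_simps)
  then have "A \<in> set (node_forms C)" by simp
  then obtain k where k: "k < length C" "node_forms C ! k = A"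
    by (auto simp: in_set_conv_nth)
  \<comment> \<open>The output is the last node, so everything after the node for \<open>A\<close>
    is cut off; inputs point backwards and survive.\<close>
  let ?C = "take (Suc k) C"
  have "length (node_forms C) = card (subforms A)"
    using distinct_card[OF C(2)] C(3) by simp
  then have "circuit_size ?C \<le> card (subforms A)"
    using k(1) by (simp add: circuit_size_def)
  moreover have "node_forms ?C = take k (node_forms C) @ [A]"
    using k take_Suc_conv_app_nth[of k "node_forms C"] take_node_forms[of "Suc k" C] by simp
  then have "unfolding_form ?C = A"
    by (simp add: unfolding_form_def)
  moreover have "monotone_circuit ?C"
    using C(1) k(1) by (auto simp: monotone_circuit_def topo_ordered_def)
  ultimately show ?thesis by blast
qed

section \<open>The stages of the Horn closure\<close>

definition big_conj :: "form list \<Rightarrow> form" where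
  "big_conj As = foldr Conj As \<^bold>\<top>"

definition big_disj :: "form list \<Rightarrow> form" where
  "big_disj As = foldr Disj As \<^bold>\<bottom>"

lemma holds_big_conj [simp]: "holds a (big_conj As) \<longleftrightarrow> (\<forall>A \<in> set As. holds a A)"
  by (induction As) (auto simp: big_conj_def)

lemma holds_big_disj [simp]: "holds a (big_disj As) \<longleftrightarrow> (\<exists>A \<in> set As. holds a A)"
  by (induction As) (auto simp: big_disj_def)

lemma monotone_big_conj [simp]: "monotone_form (big_conj As) \<longleftrightarrow> (\<forall>A \<in> set As. monotone_form A)"
  by (induction As) (auto simp: big_conj_def)

lemma monotone_big_disj [simp]: "monotone_form (big_disj As) \<longleftrightarrow> (\<forall>A \<in> set As. monotone_form A)"
  by (induction As) (auto simp: big_disj_def)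

lemma atoms_big_conj [simp]: "atoms (big_conj As) = (\<Union>A \<in> set As. atoms A)"
  by (induction As) (auto simp: big_conj_def)

lemma atoms_big_disj [simp]: "atoms (big_disj As) = (\<Union>A \<in> set As. atoms A)"
  by (induction As) (auto simp: big_disj_def)

lemma ded_big_conjD: "ded \<Gamma> (big_conj As) \<Longrightarrow> A \<in> set As \<Longrightarrow> ded \<Gamma> A"
  by (induction As) (auto simp: big_conj_def intro: ded_conjD1 ded_conjD2)

lemma ded_big_disjL: "(\<And>A. A \<in> set As \<Longrightarrow> ded {A} C) \<Longrightarrow> ded {big_disj As} C"
  by (induction As) (auto simp: big_disj_def intro: ded_disjL ded_botE ded.assm)

text \<open>Only nodes outside the already available set \<open>G\<close> are counted: one
  conjunction per list entry and the final top.\<close>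

lemma card_subforms_big_conj:
  assumes "\<And>A. A \<in> set As \<Longrightarrow> subforms A \<subseteq> G"
  shows "card (subforms (big_conj As) - G) \<le> Suc (length As)"
  using assms
proof (induction As)
  case Nil
  show ?case using card_mono[of "{\<^bold>\<top>}" "{\<^bold>\<top>} - G"] by (simp add: big_conj_def)
next
  case (Cons A As)
  have "card (subforms (big_conj (A # As)) - G) \<le>
      card (insert (big_conj (A # As)) (subforms (big_conj As) - G))"
    using Cons.prems[of A] by (intro card_mono) (auto simp: big_conj_def)
  also have "\<dots> \<le> Suc (card (subforms (big_conj As) - G))" by (simp add: card_insert_le_m1)
  finally show ?case using Cons.IH Cons.prems by fastforce
qed

lemma card_subforms_big_disj:
  "card (subforms (big_disj As) - G) \<le> Suc (\<Sum>A\<leftarrow>As. Suc (card (subforms A - G)))"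
proof (induction As)
  case Nil
  show ?case using card_mono[of "{\<^bold>\<bottom>}" "{\<^bold>\<bottom>} - G"] by (simp add: big_disj_def)
next
  case (Cons A As)
  have "card (subforms (big_disj (A # As)) - G) \<le>
      card (insert (big_disj (A # As)) ((subforms A - G) \<union> (subforms (big_disj As) - G)))"
    by (intro card_mono) (auto simp: big_disj_def)
  also have "\<dots> \<le> Suc (card ((subforms A - G) \<union> (subforms (big_disj As) - G)))"
    by (simp add: card_insert_le_m1)
  also have "\<dots> \<le> Suc (card (subforms A - G) + card (subforms (big_disj As) - G))"
    by (simp add: card_Un_le)
  finally show ?case using Cons.IH by simp
qed

text \<open>The Horn clauses that need no proof line. Implications get falsum here, so they enter
  the closure only through lines; atoms outside \<open>P\<close> get falsum to keep the interpolants
  in the allowed atoms.\<close>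

fun base_form :: "nat set \<Rightarrow> (form \<Rightarrow> form) \<Rightarrow> form \<Rightarrow> form" where
  "base_form P X (Atom n) = (if n \<in> P then Atom n else \<^bold>\<bottom>)"
| "base_form P X \<^bold>\<top> = \<^bold>\<top>"
| "base_form P X (A \<^bold>\<and> B) = X A \<^bold>\<and> X B"
| "base_form P X (A \<^bold>\<or> B) = X A \<^bold>\<or> X B"
| "base_form P X A = \<^bold>\<bottom>"

text \<open>
  \<open>stage P \<pi> t A\<close> says that \<open>A\<close> enters the closure within \<open>t\<close> rounds, as a monotone formula in the
  atoms \<open>P\<close>.
\<close>

primrec stage :: "nat set \<Rightarrow> sequent list \<Rightarrow> nat \<Rightarrow> form \<Rightarrow> form" where
  "stage P \<pi> 0 = (\<lambda>A. \<^bold>\<bottom>)"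
| "stage P \<pi> (Suc t) = (\<lambda>A. base_form P (stage P \<pi> t) A \<^bold>\<or>
     big_disj (map (\<lambda>S. big_conj (map (stage P \<pi> t) (ante S))) (filter (\<lambda>S. succ S = [A]) \<pi>)))"

lemma monotone_stage: "monotone_form (stage P \<pi> t A)"
proof (induction t arbitrary: A)
  case (Suc t)
  then show ?case by (cases A) auto
qed simp

lemma atoms_stage: "atoms (stage P \<pi> t A) \<subseteq> P"
proof (induction t arbitrary: A)
  case (Suc t)
  then have "atoms (base_form P (stage P \<pi> t) A) \<subseteq> P" by (cases A) auto
  with Suc show ?case by auto
qed simp

text \<open>Each disjunct of a stage implies \<open>A\<close>: the base clause by introduction
  rules, a line by cutting its soundness with the induction hypothesis for its antecedent.\<close>

lemma stage_sound:
  assumes "\<And>S. S \<in> set \<pi> \<Longrightarrow> ded (set (ante S)) (succ_form (succ S))"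
  shows "ded {stage P \<pi> t A} A"
proof (induction t arbitrary: A)
  case 0
  show ?case by (simp add: ded_botE ded.assm)
next
  case (Suc t)
  have stage_ded: "ded \<Gamma> B" if "ded \<Gamma> (stage P \<pi> t B)" for \<Gamma> B
    using that by (auto intro: ded_cut[OF Suc])
  have "ded {base_form P (stage P \<pi> t) A} A"
  proof (cases A)
    case (Conj B C)
    let ?D = "stage P \<pi> t B \<^bold>\<and> stage P \<pi> t C"
    have "ded {?D} ?D" by (simp add: ded.assm)
    then have "ded {?D} B" "ded {?D} C"
      by (blast intro: stage_ded dest: ded_conjD1 ded_conjD2)+
    with Conj show ?thesis by (simp add: ded_conjI)
  next
    case (Disj B C)
    then show ?thesis by (simp add: ded_disjL ded_disjI1 ded_disjI2 Suc)
  qed (simp_all add: ded_botE ded.assm)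
  moreover have "ded {big_conj (map (stage P \<pi> t) (ante S))} A"
    if S: "S \<in> set \<pi>" "succ S = [A]" for S
  proof (rule ded_cut)
    show "ded (set (ante S)) A" using assms[OF S(1)] S(2) by simp
    show "ded {big_conj (map (stage P \<pi> t) (ante S))} B" if "B \<in> set (ante S)" for B
    proof (rule stage_ded[OF ded_big_conjD])
      show "ded {big_conj (map (stage P \<pi> t) (ante S))} (big_conj (map (stage P \<pi> t) (ante S)))"
        by (simp add: ded.assm)
    qed (use that in simp)
  qed
  then have "ded {big_disj (map (\<lambda>S. big_conj (map (stage P \<pi> t) (ante S)))
      (filter (\<lambda>S. succ S = [A]) \<pi>))} A"
    by (intro ded_big_disjL) auto
  ultimately show ?case by (simp add: ded_disjL)
qed

section \<open>Subformulas of a proof\<close>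

definition proof_subforms :: "sequent list \<Rightarrow> form set" where
  "proof_subforms \<pi> = (\<Union>S \<in> set \<pi>. \<Union>A \<in> set (ante S) \<union> set (succ S). subforms A)"

lemma finite_proof_subforms [simp]: "finite (proof_subforms \<pi>)"
  by (simp add: proof_subforms_def)

lemma proof_subforms_closed: "A \<in> proof_subforms \<pi> \<Longrightarrow> subforms A \<subseteq> proof_subforms \<pi>"
  unfolding proof_subforms_def by (blast dest: subforms_trans)

lemma proof_subforms_immediate:
  "A \<^bold>\<and> B \<in> proof_subforms \<pi> \<Longrightarrow> A \<in> proof_subforms \<pi> \<and> B \<in> proof_subforms \<pi>"
  "A \<^bold>\<or> B \<in> proof_subforms \<pi> \<Longrightarrow> A \<in> proof_subforms \<pi> \<and> B \<in> proof_subforms \<pi>"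
  "A \<^bold>\<rightarrow> B \<in> proof_subforms \<pi> \<Longrightarrow> A \<in> proof_subforms \<pi> \<and> B \<in> proof_subforms \<pi>"
  by (auto dest!: proof_subforms_closed)

lemma sequent_proof_subforms:
  "S \<in> set \<pi> \<Longrightarrow> set (ante S) \<subseteq> proof_subforms \<pi>"
  "S \<in> set \<pi> \<Longrightarrow> set (succ S) \<subseteq> proof_subforms \<pi>"
  by (fastforce simp: proof_subforms_def)+

section \<open>Size of the stages\<close>

text \<open>In prefix notation each occurrence of a subformula starts at its own symbol.\<close>

lemma card_subforms_le_code: "card (subforms A) \<le> length (form_code A)"
proof (induction A)
  case (Conj A B)
  then show ?case using card_Un_le[of "subforms A" "subforms B"]
    by (auto intro!: order_trans[OF card_insert_le_m1] simp: card_insert_if)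
next
  case (Disj A B)
  then show ?case using card_Un_le[of "subforms A" "subforms B"]
    by (auto intro!: order_trans[OF card_insert_le_m1] simp: card_insert_if)
next
  case (Imp A B)
  then show ?case using card_Un_le[of "subforms A" "subforms B"]
    by (auto intro!: order_trans[OF card_insert_le_m1] simp: card_insert_if)
qed auto

lemma length_form_code_pos: "0 < length (form_code A)"
  by (cases A) auto

lemma length_le_forms_code: "length \<Gamma> \<le> length (forms_code \<Gamma>)"
proof (induction \<Gamma>)
  case (Cons A \<Gamma>)
  have "length (forms_code (A # \<Gamma>)) = length (form_code A) + length (forms_code \<Gamma>)"
    by (simp add: forms_code_def)
  with Cons length_form_code_pos[of A] show ?case by (simp del: length_greater_0_conv)
qed simp

lemma card_subforms_le_forms_code:
  "card (\<Union>A \<in> set \<Gamma>. subforms A) \<le> length (forms_code \<Gamma>)"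
proof (induction \<Gamma>)
  case (Cons A \<Gamma>)
  then show ?case
    using card_subforms_le_code[of A] card_Un_le[of "subforms A" "\<Union>A \<in> set \<Gamma>. subforms A"]
    by (simp add: forms_code_def)
qed simp

lemma card_proof_subforms: "card (proof_subforms \<pi>) \<le> length (proof_code \<pi>)"
proof (induction \<pi>)
  case (Cons S \<pi>)
  obtain \<Gamma> \<Delta> where S: "S = (\<Gamma> \<^bold>\<turnstile> \<Delta>)" by (cases S)
  have "proof_subforms (S # \<pi>) =
      (\<Union>A \<in> set \<Gamma>. subforms A) \<union> (\<Union>A \<in> set \<Delta>. subforms A) \<union> proof_subforms \<pi>"
    by (simp add: S proof_subforms_def UN_Un)
  also have "card \<dots> \<le> length (forms_code \<Gamma>) + length (forms_code \<Delta>) + length (proof_code \<pi>)"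
    by (intro order_trans[OF card_Un_le] add_mono card_subforms_le_forms_code Cons)
  finally show ?case by (simp add: S proof_code_def)
qed (simp add: proof_subforms_def)

text \<open>The 2 is paid by the turnstile and the end marker; it will cover the top ending a line's
  conjunction and the disjunction node joining that line.\<close>

lemma sum_ante_le_code: "(\<Sum>S\<leftarrow>\<pi>. length (ante S) + 2) \<le> length (proof_code \<pi>)"
proof (induction \<pi>)
  case (Cons S \<pi>)
  then show ?case
    using length_le_forms_code[of "ante S"] by (cases S) (simp add: proof_code_def)
qed simp

text \<open>All formulas of a round are counted jointly, so that parts shared between them count
  once.\<close>

definition stage_subforms :: "nat set \<Rightarrow> sequent list \<Rightarrow> nat \<Rightarrow> form set" where
  "stage_subforms P \<pi> t = (\<Union>A \<in> proof_subforms \<pi>. subforms (stage P \<pi> t A))"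

text \<open>Entries of the previous round are reused as nodes. The 3 stands for the top node of the
  base clause, the falsum ending the big disjunction, and the outer disjunction.\<close>

lemma card_stage_step:
  assumes "A \<in> proof_subforms \<pi>"
  shows "card (subforms (stage P \<pi> (Suc t) A) - stage_subforms P \<pi> t) \<le> length (proof_code \<pi>) + 3"
proof -
  let ?G = "stage_subforms P \<pi> t" and ?X = "stage P \<pi> t"
  let ?c = "\<lambda>S. big_conj (map ?X (ante S))" and ?\<pi> = "filter (\<lambda>S. succ S = [A]) \<pi>"
  have G: "subforms (?X B) \<subseteq> ?G" if "B \<in> proof_subforms \<pi>" for B
    using that by (auto simp: stage_subforms_def)
  have "subforms (base_form P ?X A) - ?G \<subseteq> {base_form P ?X A}"
    using assms G by (cases A) (auto dest!: proof_subforms_immediate)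
  from card_mono[OF _ this] have base: "card (subforms (base_form P ?X A) - ?G) \<le> 1" by simp
  have "card (subforms (big_disj (map ?c ?\<pi>)) - ?G) \<le> Suc (\<Sum>S\<leftarrow>?\<pi>. Suc (card (subforms (?c S) - ?G)))"
    using card_subforms_big_disj[of "map ?c ?\<pi>" ?G] by (simp add: comp_def)
  also have "(\<Sum>S\<leftarrow>?\<pi>. Suc (card (subforms (?c S) - ?G))) \<le> (\<Sum>S\<leftarrow>?\<pi>. length (ante S) + 2)"
  proof (rule sum_list_mono)
    fix S assume "S \<in> set ?\<pi>"
    then have "card (subforms (?c S) - ?G) \<le> Suc (length (map ?X (ante S)))"
      using G sequent_proof_subforms(1) by (intro card_subforms_big_conj) auto
    then show "Suc (card (subforms (?c S) - ?G)) \<le> length (ante S) + 2" by simp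
  qed
  also have "(\<Sum>S\<leftarrow>?\<pi>. length (ante S) + 2) \<le> (\<Sum>S\<leftarrow>\<pi>. length (ante S) + 2)"
    by (rule sum_list_filter_le_nat)
  also note sum_ante_le_code
  finally have disj: "card (subforms (big_disj (map ?c ?\<pi>)) - ?G) \<le> Suc (length (proof_code \<pi>))"
    by simp
  let ?U = "(subforms (base_form P ?X A) - ?G) \<union> (subforms (big_disj (map ?c ?\<pi>)) - ?G)"
  have "card (subforms (stage P \<pi> (Suc t) A) - ?G) \<le> card (insert (stage P \<pi> (Suc t) A) ?U)"
    by (intro card_mono) auto
  also have "\<dots> \<le> Suc (card ?U)" by (simp add: card_insert_if)
  also have "card ?U \<le> 1 + Suc (length (proof_code \<pi>))"
    by (intro order_trans[OF card_Un_le] add_mono base disj)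
  finally show ?thesis by simp
qed

text \<open>Round 0 is the single node falsum; each later round adds at most n + 3 nodes for each of
  at most n formulas.\<close>

lemma card_stage_subforms:
  fixes \<pi>
  defines "n \<equiv> length (proof_code \<pi>)"
  shows "card (stage_subforms P \<pi> t) \<le> 1 + t * (n * (n + 3))"
proof (induction t)
  case 0
  have "stage_subforms P \<pi> 0 \<subseteq> {\<^bold>\<bottom>}" by (auto simp: stage_subforms_def)
  then show ?case using card_mono[of "{\<^bold>\<bottom>}"] by fastforce
next
  case (Suc t)
  let ?F = "proof_subforms \<pi>" and ?G = "stage_subforms P \<pi>"
  let ?new = "\<Union>A \<in> ?F. subforms (stage P \<pi> (Suc t) A) - ?G t"
  have "card ?new \<le> (\<Sum>A\<in>?F. card (subforms (stage P \<pi> (Suc t) A) - ?G t))"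
    by (rule card_UN_le) simp
  also have "\<dots> \<le> (\<Sum>A\<in>?F. n + 3)"
    unfolding n_def by (intro sum_mono card_stage_step)
  also have "\<dots> \<le> n * (n + 3)"
    using card_proof_subforms[of \<pi>] by (simp add: n_def)
  finally have new: "card ?new \<le> n * (n + 3)" .
  have "card (?G (Suc t)) \<le> card (?G t \<union> ?new)"
    by (intro card_mono) (auto simp: stage_subforms_def)
  also have "\<dots> \<le> (1 + t * (n * (n + 3))) + n * (n + 3)"
    by (intro order_trans[OF card_Un_le] add_mono Suc new)
  finally show ?case by (simp add: algebra_simps)
qed

section \<open>The fixed point\<close>

fun base_holds :: "nat set \<Rightarrow> form set \<Rightarrow> form \<Rightarrow> bool" where
  "base_holds a T (Atom n) \<longleftrightarrow> n \<in> a"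
| "base_holds a T \<^bold>\<top> \<longleftrightarrow> True"
| "base_holds a T (A \<^bold>\<and> B) \<longleftrightarrow> A \<in> T \<and> B \<in> T"
| "base_holds a T (A \<^bold>\<or> B) \<longleftrightarrow> A \<in> T \<or> B \<in> T"
| "base_holds a T A \<longleftrightarrow> False"

text \<open>The semantic counterpart of one round of \<open>stage\<close> under a fixed assignment;
  filtering by \<open>proof_subforms\<close> keeps the iteration inside a finite set.\<close>

definition closure_step :: "sequent list \<Rightarrow> nat set \<Rightarrow> form set \<Rightarrow> form set" where
  "closure_step \<pi> a T = {A \<in> proof_subforms \<pi>.
     base_holds a T A \<or> (\<exists>S \<in> set \<pi>. succ S = [A] \<and> set (ante S) \<subseteq> T)}"

lemma base_holds_mono: "base_holds a T A \<Longrightarrow> T \<subseteq> T' \<Longrightarrow> base_holds a T' A"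
  by (cases A) auto

lemma mono_closure_step: "mono (closure_step \<pi> a)"
  unfolding closure_step_def by (rule monoI) (blast intro: base_holds_mono)

text \<open>The assignment is cut down to \<open>P\<close> because \<open>base_form\<close> replaces
  all other atoms by falsum.\<close>

lemma holds_stage_iff:
  "A \<in> proof_subforms \<pi> \<Longrightarrow>
    holds a (stage P \<pi> t A) \<longleftrightarrow> A \<in> (closure_step \<pi> (a \<inter> P) ^^ t) {}"
proof (induction t arbitrary: A)
  case (Suc t)
  let ?T = "(closure_step \<pi> (a \<inter> P) ^^ t) {}"
  have base: "holds a (base_form P (stage P \<pi> t) A) \<longleftrightarrow> base_holds (a \<inter> P) ?T A"
    using Suc by (cases A) (auto dest: proof_subforms_immediate)
  have lines: "(\<forall>B \<in> set (ante S). holds a (stage P \<pi> t B)) \<longleftrightarrow> set (ante S) \<subseteq> ?T"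
    if "S \<in> set \<pi>" for S
    using Suc.IH sequent_proof_subforms(1)[OF that] by blast
  have "holds a (stage P \<pi> (Suc t) A) \<longleftrightarrow> holds a (base_form P (stage P \<pi> t) A) \<or>
      (\<exists>S \<in> set \<pi>. succ S = [A] \<and> (\<forall>B \<in> set (ante S). holds a (stage P \<pi> t B)))"
    by auto
  also have "\<dots> \<longleftrightarrow> base_holds (a \<inter> P) ?T A \<or> (\<exists>S \<in> set \<pi>. succ S = [A] \<and> set (ante S) \<subseteq> ?T)"
    unfolding base by (simp add: lines cong: bex_cong)
  also have "\<dots> \<longleftrightarrow> A \<in> (closure_step \<pi> (a \<inter> P) ^^ Suc t) {}"
    using Suc.prems by (simp add: closure_step_def)
  finally show ?case .
qed simp

text \<open>An increasing chain of subsets of a finite set stalls within as many rounds as the set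
  has elements, and is constant from then on.\<close>

lemma closure_step_fixpoint:
  fixes \<pi> a
  defines "T \<equiv> (closure_step \<pi> a ^^ card (proof_subforms \<pi>)) {}"
  shows "closure_step \<pi> a T = T"
proof -
  let ?f = "\<lambda>t. (closure_step \<pi> a ^^ t) {}"
  have sub: "?f t \<subseteq> proof_subforms \<pi>" for t by (cases t) (auto simp: closure_step_def)
  have inc: "?f t \<subseteq> ?f (Suc t)" for t
    by (induction t) (simp_all add: monoD[OF mono_closure_step])
  have "\<exists>t \<le> card (proof_subforms \<pi>). ?f t = ?f (Suc t)"
  proof (rule ccontr)
    assume "\<not> ?thesis"
    with inc have strict: "?f t \<subset> ?f (Suc t)" if "t \<le> card (proof_subforms \<pi>)" for t
      using that by (simp add: psubset_eq del: funpow.simps)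
    \<comment> \<open>If the chain never stalled, round
      \<open>Suc (card (proof_subforms \<pi>))\<close> would have more elements than the set
      containing it.\<close>
    have "t \<le> card (?f t)" if "t \<le> Suc (card (proof_subforms \<pi>))" for t
      using that
    proof (induction t)
      case (Suc t)
      then have "card (?f t) < card (?f (Suc t))"
        by (intro psubset_card_mono strict finite_subset[OF sub]) auto
      with Suc show ?case by linarith
    qed simp
    from this[OF order_refl] card_mono[OF finite_proof_subforms sub[of "Suc (card (proof_subforms \<pi>))"]]
    show False by linarith
  qed
  then obtain t where t: "t \<le> card (proof_subforms \<pi>)" "?f t = ?f (Suc t)" by blast
  have "?f (k + t) = ?f t" for k
  proof (induction k)
    case (Suc k)
    have "?f (Suc k + t) = closure_step \<pi> a (?f (k + t))" by simp
    also have "\<dots> = ?f (Suc t)" unfolding Suc by simp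
    finally show ?case using t(2) by (rule trans[OF _ sym])
  qed simp
  from this[of "card (proof_subforms \<pi>) - t"] t(1) have "T = ?f t" by (simp add: T_def)
  with t(2) show ?thesis by (metis funpow.simps(2) comp_apply)
qed

section \<open>Kleene's slash relative to the fixed point\<close>

fun slash :: "form set \<Rightarrow> form \<Rightarrow> bool" where
  "slash T (Atom n) \<longleftrightarrow> Atom n \<in> T"
| "slash T \<^bold>\<top> \<longleftrightarrow> True"
| "slash T \<^bold>\<bottom> \<longleftrightarrow> False"
| "slash T (A \<^bold>\<and> B) \<longleftrightarrow> slash T A \<and> slash T B"
| "slash T (A \<^bold>\<or> B) \<longleftrightarrow> slash T A \<or> slash T B"
| "slash T (A \<^bold>\<rightarrow> B) \<longleftrightarrow> A \<^bold>\<rightarrow> B \<in> T \<and> (slash T A \<longrightarrow> slash T B)"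

text \<open>For atoms and implications membership is part of the slash; the other connectives use
  closure of \<open>T\<close> under the base clauses.\<close>

lemma slash_in_fixpoint:
  assumes "closure_step \<pi> a T = T"
  shows "A \<in> proof_subforms \<pi> \<Longrightarrow> slash T A \<Longrightarrow> A \<in> T"
proof (induction A)
  case Top
  then show ?case by (subst assms[symmetric]) (simp add: closure_step_def)
next
  case (Conj A B)
  then show ?case
    by (subst assms[symmetric]) (auto simp: closure_step_def dest: proof_subforms_immediate)
next
  case (Disj A B)
  then show ?case
    by (subst assms[symmetric]) (auto simp: closure_step_def dest: proof_subforms_immediate)
qed simp_all

lemma slash_monotone:
  assumes "closure_step \<pi> a T = T"
  shows "A \<in> proof_subforms \<pi> \<Longrightarrow> monotone_form A \<Longrightarrow> holds a A \<Longrightarrow> slash T A"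
proof (induction A)
  case (Atom n)
  then show ?case by simp (subst assms[symmetric], simp add: closure_step_def)
qed (auto dest: proof_subforms_immediate)

lemma holds_restrict: "atoms A \<subseteq> P \<Longrightarrow> holds (a \<inter> P) A \<longleftrightarrow> holds a A"
  by (induction A) auto

text \<open>Only \<open>ImpR\<close> needs the closure properties of \<open>T\<close>, since a
  slashed implication must belong to \<open>T\<close>.\<close>

lemma LK_rule_slash:
  assumes "LK_rule Ps S"
    "\<forall>P \<in> set Ps. length (succ P) \<le> 1 \<and> ((\<forall>A \<in> set (ante P). slash T A) \<longrightarrow> slash T (succ_form (succ P)))"
    and "length (succ S) \<le> 1"
    and T: "\<And>A. set (ante S) \<subseteq> T \<Longrightarrow> succ S = [A] \<Longrightarrow> A \<in> T"
    and ante: "\<And>A. A \<in> set (ante S) \<Longrightarrow> slash T A \<Longrightarrow> A \<in> T"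
  shows "(\<forall>A \<in> set (ante S). slash T A) \<longrightarrow> slash T (succ_form (succ S))"
  using assms(1)
proof (cases rule: LK_rule.cases)
  case (ImpR A \<Gamma> \<Delta> B)
  \<comment> \<open>Slashed antecedents lie in \<open>T\<close>, so the line itself puts its
    implication into \<open>T\<close>.\<close>
  have "set (ante S) \<subseteq> T" if "\<forall>A \<in> set (ante S). slash T A" using that ante by blast
  with ImpR assms(2,3) T show ?thesis by auto
qed (use assms(2,3) in \<open>auto\<close>)

lemma LJ_slash:
  assumes "LJ_derivation \<pi>" "closure_step \<pi> a T = T" "S \<in> set \<pi>" "\<forall>A \<in> set (ante S). slash T A"
  shows "slash T (succ_form (succ S))"
proof -
  have "(\<forall>A \<in> set (ante S). slash T A) \<longrightarrow> slash T (succ_form (succ S))"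
    using assms(1,3)
  proof (rule LJ_derivation_induct)
    fix Ps S
    assume S: "S \<in> set \<pi>" "LK_rule Ps S" "length (succ S) \<le> 1"
      and IH: "\<And>P. P \<in> set Ps \<Longrightarrow> P \<in> set \<pi> \<and> length (succ P) \<le> 1 \<and>
        ((\<forall>A \<in> set (ante P). slash T A) \<longrightarrow> slash T (succ_form (succ P)))"
    show "(\<forall>A \<in> set (ante S). slash T A) \<longrightarrow> slash T (succ_form (succ S))"
    proof (rule LK_rule_slash[OF S(2) _ S(3)])
      fix A assume "set (ante S) \<subseteq> T" "succ S = [A]"
      then have "A \<in> closure_step \<pi> a T"
        using S(1) sequent_proof_subforms(2)[OF S(1)] by (auto simp: closure_step_def)
      then show "A \<in> T" using assms(2) by simp
    next
      fix A assume "A \<in> set (ante S)" "slash T A"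
      then show "A \<in> T"
        using slash_in_fixpoint[OF assms(2)] sequent_proof_subforms(1)[OF S(1)] by blast
    qed (use IH in blast)
  qed
  with assms(4) show ?thesis by blast
qed

section \<open>Assembling the interpolants\<close>

lemma stage_disjunction:
  fixes \<pi> \<phi>
  defines "X \<equiv> stage (atoms \<phi>) \<pi> (card (proof_subforms \<pi>))"
  assumes "LJ_derivation \<pi>" "([] \<^bold>\<turnstile> [\<phi> \<^bold>\<rightarrow> \<psi> \<^bold>\<or> \<theta>]) \<in> set \<pi>" "monotone_form \<phi>" "holds a \<phi>"
  shows "holds a (X \<psi>) \<or> holds a (X \<theta>)"
proof -
  let ?a = "a \<inter> atoms \<phi>"
  define T where "T = (closure_step \<pi> ?a ^^ card (proof_subforms \<pi>)) {}"
  have fix_T: "closure_step \<pi> ?a T = T" unfolding T_def by (rule closure_step_fixpoint)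
  have "\<phi> \<^bold>\<rightarrow> \<psi> \<^bold>\<or> \<theta> \<in> proof_subforms \<pi>"
    using sequent_proof_subforms(2)[OF assms(3)] by simp
  then have F: "\<phi> \<in> proof_subforms \<pi>" "\<psi> \<in> proof_subforms \<pi>" "\<theta> \<in> proof_subforms \<pi>"
    by (auto dest!: proof_subforms_immediate)
  have "slash T (\<phi> \<^bold>\<rightarrow> \<psi> \<^bold>\<or> \<theta>)"
    using LJ_slash[OF assms(2) fix_T assms(3)] by simp
  moreover have "slash T \<phi>"
    using slash_monotone[OF fix_T F(1) assms(4)] assms(5) holds_restrict by blast
  \<comment> \<open>The slash of a disjunction slashes one disjunct; this is where the disjunction
    property comes from.\<close>
  ultimately have "\<psi> \<in> T \<or> \<theta> \<in> T"
    using slash_in_fixpoint[OF fix_T] F by auto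
  then show ?thesis using F by (simp add: X_def T_def holds_stage_iff)
qed

theorem theorem7p10:
  "\<exists>p :: nat poly poly. \<forall>\<pi> \<phi> \<psi> \<theta> u w.
     LJ_proof \<pi> (\<phi> \<^bold>\<rightarrow> \<psi> \<^bold>\<or> \<theta>) \<longrightarrow> monotone_form \<phi> \<longrightarrow>
     u = proof_code \<pi> \<longrightarrow> w = form_code (\<phi> \<^bold>\<rightarrow> \<psi> \<^bold>\<or> \<theta>) \<longrightarrow>
     (\<exists>C D. monotone_circuit C \<and> monotone_circuit D \<and>
        circuit_size C \<le> poly2 p (length u) (length w) \<and>
        circuit_size D \<le> poly2 p (length u) (length w) \<and>
        IPC_PDI (unfolding_form C) (unfolding_form D) \<phi> \<psi> \<theta>)"
\<comment> \<open>The polynomial is 1 + 3 x^2 + x^3 in x = |u|, with coefficients constant in |w|.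
  It is the bound 1 + t * (n * (n + 3)) of \<open>card_stage_subforms\<close> with n = |u| and the
  number of rounds t bounded by n.\<close>
proof (intro exI[of _ "[:[:1:], 0, [:3:], [:1:]:]"] allI impI)
  fix \<pi> \<phi> \<psi> \<theta> u w
  assume LJ_prf: "LJ_proof \<pi> (\<phi> \<^bold>\<rightarrow> \<psi> \<^bold>\<or> \<theta>)" and mono: "monotone_form \<phi>"
    and u: "u = proof_code \<pi>"
  let ?p = "[:[:1:], 0, [:3:], [:1:]:] :: nat poly poly" and ?n = "length u"
  have p: "poly2 ?p ?n (length w) = 1 + ?n * (?n * (?n + 3))"
    by (simp add: poly2_def algebra_simps)
  have der: "LJ_derivation \<pi>" and line: "([] \<^bold>\<turnstile> [\<phi> \<^bold>\<rightarrow> \<psi> \<^bold>\<or> \<theta>]) \<in> set \<pi>"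
    using LJ_prf by (auto simp: LJ_proof_def dest: last_in_set)
  let ?X = "stage (atoms \<phi>) \<pi> (card (proof_subforms \<pi>))"
  have circuit: "\<exists>C. monotone_circuit C \<and> unfolding_form C = ?X A \<and>
      circuit_size C \<le> poly2 ?p ?n (length w)" if A: "A \<in> proof_subforms \<pi>" for A
  proof -
    have "card (subforms (?X A)) \<le> card (stage_subforms (atoms \<phi>) \<pi> (card (proof_subforms \<pi>)))"
      using A by (intro card_mono) (auto simp: stage_subforms_def)
    also have "\<dots> \<le> 1 + card (proof_subforms \<pi>) * (?n * (?n + 3))"
      unfolding u by (rule card_stage_subforms)
    also have "\<dots> \<le> 1 + ?n * (?n * (?n + 3))"
      unfolding u by (intro add_left_mono mult_right_mono card_proof_subforms) simp
    finally show ?thesis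
      using circuit_of_monotone_form[OF monotone_stage] p by (metis order_trans)
  qed
  have "\<phi> \<^bold>\<rightarrow> \<psi> \<^bold>\<or> \<theta> \<in> proof_subforms \<pi>"
    using sequent_proof_subforms(2)[OF line] by simp
  then have "\<psi> \<in> proof_subforms \<pi>" "\<theta> \<in> proof_subforms \<pi>"
    by (auto dest!: proof_subforms_immediate)
  then obtain C D where C: "monotone_circuit C" "unfolding_form C = ?X \<psi>"
      "circuit_size C \<le> poly2 ?p ?n (length w)"
    and D: "monotone_circuit D" "unfolding_form D = ?X \<theta>"
      "circuit_size D \<le> poly2 ?p ?n (length w)"
    using circuit by meson
  have "\<phi> \<^bold>\<rightarrow> \<psi> \<^bold>\<or> \<theta> \<in> IPC"
    using LJ_sound[OF der line] by (simp add: ded_empty)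
  \<comment> \<open>Both sides are monotone, so checking every assignment is enough.\<close>
  moreover have "\<phi> \<^bold>\<rightarrow> ?X \<psi> \<^bold>\<or> ?X \<theta> \<in> IPC"
    using stage_disjunction[OF der line mono]
    by (intro monotone_entails_IPC mono) (simp_all add: monotone_stage)
  moreover have "?X A \<^bold>\<rightarrow> A \<in> IPC" for A
    by (intro ded_single_imp stage_sound LJ_sound[OF der])
  ultimately have "IPC_PDI (?X \<psi>) (?X \<theta>) \<phi> \<psi> \<theta>"
    by (simp add: IPC_PDI_def atoms_stage)
  with C D show "\<exists>C D. monotone_circuit C \<and> monotone_circuit D \<and>
        circuit_size C \<le> poly2 ?p ?n (length w) \<and>
        circuit_size D \<le> poly2 ?p ?n (length w) \<and>
        IPC_PDI (unfolding_form C) (unfolding_form D) \<phi> \<psi> \<theta>"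
    by metis
qed

end
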